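(* Let $b>1$ be an integer and let $(\tau_n)_{n\ge 0}$ be a $b$-multiplicative sequence of complex numbers of modulus one, such that $\tau_{cb^k}=\tau_c$ for all $c,k\in\mathbb{N}$ and $\tau$ is not identically $1$. Put $d(b)=\sum_{c=0}^{b-1}\tau_c$ and suppose $|d(b)|>1$. Then for any fixed choice of a value of the complex logarithm $\log d(b)$ there exists a continuous, nowhere differentiable function $F:\mathbb{R}\to\mathbb{C}$, periodic of period $1$, such that $$\sum_{n=0}^{N-1}\tau_n=F(\log_b N)\,N^{\frac{\log d(b)}{\log b}}\qquad\text{for all integers } N\ge 1.$$
   Context: A sequence $f(n)$ of real or complex numbers is called $b$-multiplicative if $f(0)=1$ and $f(ab^k+c)=f(ab^k)f(c)$ for all $a,k\in\mathbb{N}$ and all integers $0\le c<b^k$. Here $\log b$ and $\log_b N$ are the real logarithms, and for $w\in\mathbb{C}$ and real $x>0$, $x^w=e^{w\log x}$ with real $\log x$. Differentiability of $F$ is that of a complex-valued function of a real variable. *)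

theory Defs
  imports "HOL-Analysis.Analysis"
begin

definition b_multiplicative :: "nat \<Rightarrow> (nat \<Rightarrow> 'a::real_normed_field) \<Rightarrow> bool" where
  "b_multiplicative b f \<longleftrightarrow>
     f 0 = 1 \<and> (\<forall>a k c. c < b ^ k \<longrightarrow> f (a * b ^ k + c) = f (a * b ^ k) * f c)"

definition nowhere_differentiable :: "(real \<Rightarrow> complex) \<Rightarrow> bool" where
  "nowhere_differentiable F \<longleftrightarrow> (\<forall>x. \<not> F differentiable (at x))"

end

theory Submission
  imports Defs
begin

text \<open>
  Let \<open>S N\<close> be the sum of \<open>\<tau> n\<close> over \<open>n < N\<close>. Since \<open>S (a * b + c) = d * S a + \<tau> a * S c\<close> for
  \<open>c \<le> b\<close>, the limit \<open>\<psi> x\<close> of \<open>S \<lfloor>b ^ k * x\<rfloor> / d ^ k\<close> exists for \<open>x \<ge> 0\<close>, stays at bounded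
  distance from \<open>S \<lfloor>x\<rfloor>\<close>, extends \<open>S\<close> and satisfies \<open>\<psi> (b * x) = d * \<psi> x\<close>. Rescaling by \<open>b ^ k\<close>
  turns the bounded distance into Hoelder continuity of \<open>\<psi>\<close>, and \<open>F x = \<psi> (b powr x) * exp (- L * x)\<close>
  is the required periodic function. If it were differentiable somewhere, \<open>\<psi>\<close> would satisfy a
  Lipschitz estimate at some \<open>y > 0\<close>. But the two neighbours of \<open>y\<close> in the grid of mesh \<open>b ^ -k\<close>
  have \<open>\<psi>\<close>-values at distance exactly \<open>\<bar>d\<bar> ^ -k\<close>, and \<open>\<bar>d\<bar> < b\<close> by the strict triangle inequality.
\<close>

text \<open>\<open>tau_digit\<close> merges multiplicativity at exponent 1 with invariance under
  appending a zero digit. Iterated, it makes \<open>\<tau> n\<close> the product of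
  \<open>\<tau>\<close> over the base-\<open>b\<close> digits of \<open>n\<close>.\<close>

locale unimodular_digit_function =
  fixes b :: nat and \<tau> :: "nat \<Rightarrow> complex"
  assumes b_gt_1: "b > 1"
    and tau_zero: "\<tau> 0 = 1"
    and tau_digit: "c < b \<Longrightarrow> \<tau> (a * b + c) = \<tau> a * \<tau> c"
    and norm_tau: "norm (\<tau> n) = 1"
    and norm_digit_sum: "norm (\<Sum>c<b. \<tau> c) > 1"
begin

definition d :: complex where "d = (\<Sum>c<b. \<tau> c)"

definition S :: "nat \<Rightarrow> complex" where "S N = (\<Sum>n<N. \<tau> n)"

definition R :: "nat \<Rightarrow> real \<Rightarrow> complex" where
  "R k x = S (nat \<lfloor>real b ^ k * x\<rfloor>) / d ^ k"

definition \<psi> :: "real \<Rightarrow> complex" where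
  "\<psi> x = lim (\<lambda>k. R k x)"

text \<open>A bound, uniform in \<open>x\<close>, for the total length of the steps from
  \<open>R k x\<close> to \<open>R (Suc k) x\<close>.\<close>

definition C :: real where
  "C = (\<Sum>k. real b * (1 / norm d) ^ Suc k)"

lemma norm_d_gt_1: "norm d > 1"
  using norm_digit_sum by (simp add: d_def)

lemma d_nonzero: "d \<noteq> 0"
  using norm_d_gt_1 by auto

lemma inverse_norm_d_less_1: "1 / norm d < 1"
  using norm_d_gt_1 by (simp add: divide_less_eq)

section \<open>Recursion for the partial sums\<close>

lemma S_Suc: "S (Suc N) = S N + \<tau> N"
  by (simp add: S_def)

lemma norm_S_le: "norm (S N) \<le> real N"
  unfolding S_def by (rule order_trans[OF norm_sum]) (simp add: norm_tau)

text \<open>The factor \<open>\<tau> a\<close> comes out of the block starting at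
  \<open>a * b\<close>. The case \<open>c = b\<close> is included because a full block is what
  \<open>S_mult_base\<close> needs.\<close>

lemma S_add_digit: "c \<le> b \<Longrightarrow> S (a * b + c) = S (a * b) + \<tau> a * S c"
proof (induction c)
  case 0
  then show ?case by (simp add: S_def)
next
  case (Suc c)
  then show ?case using tau_digit[of c a] by (simp add: S_Suc algebra_simps)
qed

lemma S_mult_base: "S (a * b) = d * S a"
proof (induction a)
  case 0
  then show ?case by (simp add: S_def)
next
  case (Suc a)
  have "S (Suc a * b) = S (a * b + b)" by (simp add: add.commute)
  also have "\<dots> = d * S a + \<tau> a * d"
    using S_add_digit[of b a] Suc by (simp add: S_def d_def)
  finally show ?case by (simp add: S_Suc algebra_simps)
qed

lemma S_mult_power: "S (a * b ^ k) = d ^ k * S a"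
proof (induction k)
  case (Suc k)
  have "a * b ^ Suc k = (a * b ^ k) * b" by simp
  then have "S (a * b ^ Suc k) = d * S (a * b ^ k)" by (metis S_mult_base)
  then show ?case using Suc by simp
qed simp

text \<open>After the full blocks there remains \<open>\<tau> (m div b) * S (m mod b)\<close>, a
  unimodular multiple of a sum of fewer than \<open>b\<close> unimodular terms.\<close>

lemma norm_S_diff_div: "norm (S m - d * S (m div b)) \<le> real b"
proof -
  have "S m = S (m div b * b + m mod b)" by simp
  also have "\<dots> = d * S (m div b) + \<tau> (m div b) * S (m mod b)"
    using b_gt_1 by (subst S_add_digit) (simp_all add: S_mult_base less_imp_le)
  finally have "norm (S m - d * S (m div b)) = norm (S (m mod b))"
    by (simp add: norm_mult norm_tau)
  also have "\<dots> \<le> real (m mod b)" by (rule norm_S_le)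
  also have "\<dots> \<le> real b" using b_gt_1 by (simp add: less_imp_le)
  finally show ?thesis .
qed

section \<open>Convergence of the rescaled sums\<close>

lemma nat_floor_mult_div: "x \<ge> 0 \<Longrightarrow> nat \<lfloor>real b * x\<rfloor> div b = nat \<lfloor>x\<rfloor>"
  using floor_divide_real_eq_div[of "int b" "real b * x"] b_gt_1
  by (simp add: nat_div_distrib)

lemma norm_R_diff:
  assumes "x \<ge> 0"
  shows "norm (R (Suc k) x - R k x) \<le> real b * (1 / norm d) ^ Suc k"
proof -
  define m where "m = nat \<lfloor>real b ^ Suc k * x\<rfloor>"
  \<comment> \<open>Dropping the last base-\<open>b\<close> digit of the finer truncation of
    \<open>x\<close> gives the coarser one.\<close>
  have m: "m div b = nat \<lfloor>real b ^ k * x\<rfloor>"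
    using nat_floor_mult_div[of "real b ^ k * x"] assms by (simp add: m_def mult.assoc)
  have "R (Suc k) x - R k x = (S m - d * S (m div b)) / d ^ Suc k"
    unfolding R_def m_def[symmetric] m[symmetric] using d_nonzero by (simp add: field_simps)
  then have "norm (R (Suc k) x - R k x) = norm (S m - d * S (m div b)) / norm d ^ Suc k"
    by (simp add: norm_divide norm_power norm_mult)
  also have "\<dots> \<le> real b / norm d ^ Suc k"
    by (intro divide_right_mono norm_S_diff_div) simp
  finally show ?thesis by (simp add: power_divide)
qed

lemma summable_C: "summable (\<lambda>k. real b * (1 / norm d) ^ Suc k)"
  using inverse_norm_d_less_1
  by (intro summable_mult) (simp add: summable_Suc_iff del: power_Suc)

text \<open>The steps are dominated by a geometric series, so their telescoping sum converges. As
  \<open>R 0 x\<close> is \<open>S (nat \<lfloor>x\<rfloor>)\<close>, the same domination bounds the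
  distance from it to the limit.\<close>

lemma
  assumes "x \<ge> 0"
  shows R_tendsto: "(\<lambda>k. R k x) \<longlonglongrightarrow> \<psi> x"
    and norm_psi_diff: "norm (\<psi> x - S (nat \<lfloor>x\<rfloor>)) \<le> C"
proof -
  let ?D = "\<lambda>k. R (Suc k) x - R k x"
  have ns: "summable (\<lambda>k. norm (?D k))"
    by (rule summable_comparison_test'[OF summable_C, of 0]) (use norm_R_diff[OF assms] in auto)
  have "(\<lambda>n. \<Sum>k<n. ?D k) \<longlonglongrightarrow> suminf ?D"
    by (rule summable_LIMSEQ[OF summable_norm_cancel[OF ns]])
  then have "(\<lambda>n. R n x - R 0 x + R 0 x) \<longlonglongrightarrow> suminf ?D + R 0 x"
    by (intro tendsto_add tendsto_const) (simp add: sum_lessThan_telescope[of "\<lambda>k. R k x"])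
  then have lim: "(\<lambda>n. R n x) \<longlonglongrightarrow> suminf ?D + R 0 x" by simp
  then have eq: "\<psi> x = suminf ?D + R 0 x" unfolding \<psi>_def by (rule limI)
  show "(\<lambda>k. R k x) \<longlonglongrightarrow> \<psi> x" using lim eq by simp
  have "norm (suminf ?D) \<le> (\<Sum>k. norm (?D k))" by (rule summable_norm[OF ns])
  also have "\<dots> \<le> C" unfolding C_def
    by (rule suminf_le[OF norm_R_diff[OF assms] ns summable_C])
  finally show "norm (\<psi> x - S (nat \<lfloor>x\<rfloor>)) \<le> C" by (simp add: eq R_def)
qed

section \<open>Functional equation and continuity of the limit\<close>

lemma psi_mult_base:
  assumes "x \<ge> 0"
  shows "\<psi> (real b * x) = d * \<psi> x"
proof -
  \<comment> \<open>Multiplying the argument by \<open>b\<close> only shifts the index of the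
    sequence.\<close>
  have "R k (real b * x) = d * R (Suc k) x" for k
    using d_nonzero by (simp add: R_def mult.left_commute mult.assoc)
  then have "(\<lambda>k. R k (real b * x)) \<longlonglongrightarrow> d * \<psi> x"
    using LIMSEQ_Suc[OF R_tendsto[OF assms]] by (simp add: tendsto_mult)
  then show ?thesis unfolding \<psi>_def[of "real b * x"] by (rule limI)
qed

lemma psi_mult_power: "x \<ge> 0 \<Longrightarrow> \<psi> (real b ^ k * x) = d ^ k * \<psi> x"
  by (induction k) (simp_all add: psi_mult_base mult.assoc)

text \<open>At an integer the sequence \<open>R k\<close> is constant, by
  \<open>S_mult_power\<close>.\<close>

lemma psi_of_nat: "\<psi> (real N) = S N"
proof -
  have "nat \<lfloor>real b ^ k * real N\<rfloor> = N * b ^ k" for k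
    by (metis floor_of_nat mult.commute nat_int of_nat_mult of_nat_power)
  then have "R k (real N) = S N" for k
    using d_nonzero by (simp add: R_def S_mult_power)
  then show ?thesis by (simp add: \<psi>_def)
qed

lemma norm_S_diff_le_1: "m \<le> n \<Longrightarrow> n \<le> Suc m \<Longrightarrow> norm (S n - S m) \<le> 1"
  by (cases "n = m") (auto simp: le_Suc_eq S_Suc norm_tau)

text \<open>The floors are equal or consecutive, so the sums differ by at most one unimodular term;
  each replacement of \<open>\<psi>\<close> by \<open>S\<close> costs \<open>C\<close>.\<close>

lemma norm_psi_diff_unit:
  assumes "0 \<le> x" "x \<le> y" "y \<le> x + 1"
  shows "norm (\<psi> y - \<psi> x) \<le> 2 * C + 1"
proof -
  have "norm (S (nat \<lfloor>y\<rfloor>) - S (nat \<lfloor>x\<rfloor>)) \<le> 1"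
  proof (rule norm_S_diff_le_1)
    show "nat \<lfloor>x\<rfloor> \<le> nat \<lfloor>y\<rfloor>" using assms by (intro nat_mono floor_mono)
    have "\<lfloor>y\<rfloor> \<le> \<lfloor>x + 1\<rfloor>" using assms by (intro floor_mono)
    then show "nat \<lfloor>y\<rfloor> \<le> Suc (nat \<lfloor>x\<rfloor>)" using assms by simp
  qed
  moreover have "norm (\<psi> y - S (nat \<lfloor>y\<rfloor>)) \<le> C" "norm (\<psi> x - S (nat \<lfloor>x\<rfloor>)) \<le> C"
    using assms by (auto intro: norm_psi_diff)
  ultimately show ?thesis by norm
qed

lemma norm_psi_diff_scaled:
  assumes "0 \<le> x" "0 \<le> y" "\<bar>y - x\<bar> \<le> 1 / real b ^ k"
  shows "norm (\<psi> y - \<psi> x) \<le> (2 * C + 1) / norm d ^ k"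
proof -
  have *: "norm (\<psi> y - \<psi> x) \<le> (2 * C + 1) / norm d ^ k"
    if "0 \<le> x" "x \<le> y" "y - x \<le> 1 / real b ^ k" for x y
  proof -
    have "real b ^ k * x \<le> real b ^ k * y" using that by (intro mult_left_mono) auto
    moreover have "real b ^ k * y \<le> real b ^ k * x + 1"
      using that b_gt_1 by (simp add: field_simps)
    ultimately have "norm (\<psi> (real b ^ k * y) - \<psi> (real b ^ k * x)) \<le> 2 * C + 1"
      using that by (intro norm_psi_diff_unit) auto
    also have "\<psi> (real b ^ k * y) - \<psi> (real b ^ k * x) = d ^ k * (\<psi> y - \<psi> x)"
      using that by (simp add: psi_mult_power right_diff_distrib)
    finally show ?thesis
      using d_nonzero by (simp add: norm_mult norm_power pos_le_divide_eq mult.commute)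
  qed
  show ?thesis
    using *[of x y] *[of y x] assms by (cases "x \<le> y") (auto simp: norm_minus_commute abs_if)
qed

lemma continuous_on_psi: "continuous_on {0..} \<psi>"
  unfolding continuous_on_iff
proof (intro ballI allI impI)
  fix x :: real and e :: real
  assume x: "x \<in> {0..}" and e: "e > 0"
  have "(\<lambda>k. (2 * C + 1) * (1 / norm d) ^ k) \<longlonglongrightarrow> (2 * C + 1) * 0"
    using inverse_norm_d_less_1 by (intro tendsto_mult tendsto_const LIMSEQ_power_zero) simp
  then have "\<forall>\<^sub>F k in sequentially. (2 * C + 1) * (1 / norm d) ^ k < e"
    using e by (intro order_tendstoD) auto
  then obtain k where k: "(2 * C + 1) / norm d ^ k < e"
    by (auto simp: eventually_sequentially power_divide)
  show "\<exists>\<delta>>0. \<forall>y\<in>{0..}. dist y x < \<delta> \<longrightarrow> dist (\<psi> y) (\<psi> x) < e"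
  proof (intro exI[of _ "1 / real b ^ k"] conjI ballI impI)
    show "1 / real b ^ k > 0" using b_gt_1 by simp
    fix y :: real assume "y \<in> {0..}" "dist y x < 1 / real b ^ k"
    then have "norm (\<psi> y - \<psi> x) \<le> (2 * C + 1) / norm d ^ k"
      using x by (intro norm_psi_diff_scaled) (auto simp: dist_real_def)
    then show "dist (\<psi> y) (\<psi> x) < e" using k by (simp add: dist_norm)
  qed
qed

section \<open>Strict bound on the digit sum and non-differentiability\<close>

lemma tau_eq_1_if_digits:
  assumes "\<And>c. c < b \<Longrightarrow> \<tau> c = 1"
  shows "\<tau> n = 1"
proof (induction n rule: less_induct)
  case (less n)
  show ?case
  proof (cases "n < b")
    case False
    then have "n div b < n" using b_gt_1 by simp
    moreover have "\<tau> n = \<tau> (n div b) * \<tau> (n mod b)"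
      using tau_digit[of "n mod b" "n div b"] b_gt_1 by simp
    ultimately show ?thesis using less assms b_gt_1 by simp
  qed (use assms in auto)
qed

text \<open>Some digit \<open>c\<close> has \<open>\<tau> c \<noteq> 1\<close>. The digits 0 and
  \<open>c\<close> together contribute less than 2 in modulus, the other \<open>b - 2\<close> digits
  at most 1 each.\<close>

lemma norm_d_less:
  assumes "\<tau> n \<noteq> 1"
  shows "norm d < real b"
proof -
  obtain c where c: "c < b" "\<tau> c \<noteq> 1" using assms tau_eq_1_if_digits by blast
  have c0: "c \<noteq> 0" using c tau_zero by metis
  \<comment> \<open>Equality in the triangle inequality would make the unimodular numbers 1 and
    \<open>\<tau> c\<close> equal.\<close>
  have "norm (1 + \<tau> c) \<noteq> 2"
  proof
    assume "norm (1 + \<tau> c) = 2"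
    then have "norm (1 + \<tau> c) = norm (1 :: complex) + norm (\<tau> c)" by (simp add: norm_tau)
    then have "norm (1 :: complex) *\<^sub>R \<tau> c = norm (\<tau> c) *\<^sub>R 1"
      by (simp only: norm_triangle_eq)
    then show False using c by (simp add: norm_tau)
  qed
  moreover have "norm (1 + \<tau> c) \<le> 2"
    using norm_triangle_ineq[of 1 "\<tau> c"] by (simp add: norm_tau)
  ultimately have lt: "norm (1 + \<tau> c) < 2" by simp
  have "d = \<tau> 0 + (\<tau> c + (\<Sum>j\<in>{..<b} - {0} - {c}. \<tau> j))"
    unfolding d_def using c c0 b_gt_1 by (simp add: sum.remove[of _ 0] sum.remove[of _ c])
  then have "norm d \<le> norm (1 + \<tau> c) + norm (\<Sum>j\<in>{..<b} - {0} - {c}. \<tau> j)"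
    by (metis add.assoc norm_triangle_ineq tau_zero)
  also have "norm (\<Sum>j\<in>{..<b} - {0} - {c}. \<tau> j) \<le> real (card ({..<b} - {0} - {c}))"
    by (rule order_trans[OF norm_sum]) (simp add: norm_tau)
  also have "card ({..<b} - {0} - {c}) = b - 2" using c c0 by (simp add: card_Diff_singleton)
  finally show ?thesis using lt b_gt_1 by simp
qed

lemma psi_not_differentiable:
  assumes "\<tau> n \<noteq> 1" and y: "y > 0"
  shows "\<not> \<psi> differentiable (at y)"
proof
  assume "\<psi> differentiable (at y)"
  then obtain D where "(\<psi> has_derivative (\<lambda>h. h *\<^sub>R D)) (at y)"
    using vector_derivative_works has_vector_derivative_def by blast
  then obtain r where r: "r > 0"
    and approx: "\<And>u. norm (u - y) < r \<Longrightarrow> norm (\<psi> u - \<psi> y - (u - y) *\<^sub>R D) \<le> 1 * norm (u - y)"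
    unfolding has_derivative_at_alt using zero_less_one by blast
  \<comment> \<open>The derivative with tolerance 1 yields this Lipschitz constant at
    \<open>y\<close>.\<close>
  define M where "M = norm D + 1"
  have Lip: "norm (\<psi> u - \<psi> y) \<le> M * \<bar>u - y\<bar>" if "\<bar>u - y\<bar> < r" for u
  proof -
    have "norm (\<psi> u - \<psi> y) \<le> norm (\<psi> u - \<psi> y - (u - y) *\<^sub>R D) + norm ((u - y) *\<^sub>R D)"
      using norm_triangle_ineq[of "\<psi> u - \<psi> y - (u - y) *\<^sub>R D" "(u - y) *\<^sub>R D"] by simp
    also have "\<dots> \<le> M * \<bar>u - y\<bar>"
      using approx[of u] that by (simp add: M_def distrib_right)
    finally show ?thesis .
  qed
  have bound: "1 \<le> M * (norm d / real b) ^ k" if k: "1 / real b ^ k < r" for k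
  proof -
    define B where "B = real b ^ k"
    define m where "m = nat \<lfloor>B * y\<rfloor>"
    define u where "u = real m / B"
    define v where "v = real (Suc m) / B"
    have B: "B > 0" using b_gt_1 by (simp add: B_def)
    have "real m \<le> B * y" "B * y < real m + 1"
      using B y by (simp_all add: m_def)
    then have uy: "u \<le> y" and yv: "y < v" using B by (simp_all add: u_def v_def field_simps)
    have uv: "v - u = 1 / B" by (simp add: u_def v_def diff_divide_distrib[symmetric])
    \<comment> \<open>Scaling by \<open>b ^ k\<close> sends the grid points \<open>u\<close> and
      \<open>v\<close> to consecutive integers, where \<open>\<psi>\<close> is
      \<open>S\<close>.\<close>
    have "d ^ k * \<psi> v = S (Suc m)" "d ^ k * \<psi> u = S m"
      using B psi_mult_power[of v k] psi_mult_power[of u k]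
      by (simp_all add: psi_of_nat[symmetric] u_def v_def B_def[symmetric] del: of_nat_Suc)
    then have "d ^ k * (\<psi> v - \<psi> u) = \<tau> m" by (simp add: algebra_simps S_Suc)
    then have "1 = norm (d ^ k * (\<psi> v - \<psi> u))" by (simp add: norm_tau)
    also have "\<dots> = norm d ^ k * norm (\<psi> v - \<psi> u)" by (simp only: norm_mult norm_power)
    finally have scaled: "norm d ^ k * norm (\<psi> v - \<psi> u) = 1" by simp
    have "norm (\<psi> v - \<psi> u) \<le> M / B"
    proof -
      have "norm (\<psi> v - \<psi> u) \<le> norm (\<psi> v - \<psi> y) + norm (\<psi> u - \<psi> y)"
        using norm_triangle_ineq4[of "\<psi> v - \<psi> y" "\<psi> u - \<psi> y"] by simp
      \<comment> \<open>Both neighbours lie within \<open>1 / B < r\<close> of \<open>y\<close>; as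
        \<open>y\<close> is between them, the two distances add up to the mesh.\<close>
      also have "\<dots> \<le> M * \<bar>v - y\<bar> + M * \<bar>u - y\<bar>"
        using uv uy yv k by (intro add_mono Lip) (auto simp: B_def)
      also have "\<dots> = M * (v - u)" using uy yv by (simp add: algebra_simps)
      finally show ?thesis by (simp add: uv)
    qed
    then have "norm d ^ k * norm (\<psi> v - \<psi> u) \<le> norm d ^ k * (M / B)"
      by (intro mult_left_mono) simp_all
    then show ?thesis using scaled by (simp add: power_divide B_def mult.commute)
  qed
  \<comment> \<open>For large \<open>k\<close> the grid is finer than \<open>r\<close>, yet the
    lower bound 1 fails because \<open>norm d < real b\<close>.\<close>
  have "(\<lambda>k. M * (norm d / real b) ^ k) \<longlonglongrightarrow> M * 0"
    using norm_d_less[OF assms(1)] b_gt_1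
    by (intro tendsto_mult tendsto_const LIMSEQ_power_zero) simp
  then have "\<forall>\<^sub>F k in sequentially. M * (norm d / real b) ^ k < 1"
    by (rule order_tendstoD) simp
  moreover have "(\<lambda>k. (1 / real b) ^ k) \<longlonglongrightarrow> 0"
    using b_gt_1 by (intro LIMSEQ_power_zero) simp
  then have "\<forall>\<^sub>F k in sequentially. (1 / real b) ^ k < r"
    using r by (rule order_tendstoD)
  ultimately have "\<forall>\<^sub>F k in sequentially. False"
  proof eventually_elim
    case (elim k)
    then show False using bound[of k] by (simp add: power_divide)
  qed
  then show False by simp
qed

end

section \<open>Passage to the periodic function\<close>

theorem mainTheorem3:
  fixes b :: nat and \<tau> :: "nat \<Rightarrow> complex" and L :: complex
  assumes "b > 1"
    and "b_multiplicative b \<tau>"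
    and "\<And>n. cmod (\<tau> n) = 1"
    and "\<And>c k. \<tau> (c * b ^ k) = \<tau> c"
    and "\<exists>n. \<tau> n \<noteq> 1"
    and "cmod (\<Sum>c<b. \<tau> c) > 1"
    and "exp L = (\<Sum>c<b. \<tau> c)"
  shows "\<exists>F :: real \<Rightarrow> complex.
           continuous_on UNIV F \<and> nowhere_differentiable F \<and> (\<forall>x. F (x + 1) = F x) \<and>
           (\<forall>N::nat. N \<ge> 1 \<longrightarrow>
              (\<Sum>n<N. \<tau> n) =
                F (log (real b) (real N)) *
                  complex_of_real (real N) powr (L / complex_of_real (ln (real b))))"
proof -
  interpret unimodular_digit_function b \<tau>
  proof
    show "\<tau> (a * b + c) = \<tau> a * \<tau> c" if "c < b" for a c
      using assms(2,4) that unfolding b_multiplicative_def by (metis power_one_right)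
  qed (use assms in \<open>auto simp: b_multiplicative_def\<close>)
  obtain n where n: "\<tau> n \<noteq> 1" using assms(5) by blast
  define F where "F = (\<lambda>x. \<psi> (real b powr x) * exp (- of_real x * L))"
  have expL: "exp L = d" using assms(7) by (simp add: d_def)
  have "continuous_on UNIV F"
    unfolding F_def using b_gt_1
    by (intro continuous_intros continuous_on_compose2[OF continuous_on_psi]) auto
  moreover have "nowhere_differentiable F"
    unfolding nowhere_differentiable_def
  proof (intro allI notI)
    fix x assume F: "F differentiable (at x)"
    define y where "y = real b powr x"
    have y: "y > 0" "log (real b) y = x" using b_gt_1 by (simp_all add: y_def)
    have "log (real b) differentiable (at y)"
      using DERIV_log[of y "real b"] y real_differentiable_def by blast
    \<comment> \<open>Removing the smooth exponential factor and substituting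
      \<open>log (real b)\<close> recovers \<open>\<psi>\<close> from \<open>F\<close>.\<close>
    moreover have "(\<lambda>t. F t * exp (of_real t * L)) differentiable (at x)"
    proof -
      have "((\<lambda>t. exp (of_real t * L)) has_vector_derivative L * exp (of_real x * L)) (at x)"
        by (auto intro!: derivative_eq_intros has_vector_derivative_real_field)
      then show ?thesis
        using F by (intro differentiable_mult) (auto simp: has_vector_derivative_def differentiable_def)
    qed
    ultimately have "((\<lambda>t. F t * exp (of_real t * L)) \<circ> log (real b)) differentiable (at y)"
      using y by (intro differentiable_chain_at) auto
    then have "\<psi> differentiable (at y)"
    \<comment> \<open>The composition agrees with \<open>\<psi>\<close> at positive arguments;
      radius \<open>y\<close> stays among them.\<close>
    proof (rule differentiable_transform_within[where d = y])
      fix u assume "dist u y < y"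
      then have "u > 0" by (auto simp: dist_real_def)
      then show "((\<lambda>t. F t * exp (of_real t * L)) \<circ> log (real b)) u = \<psi> u"
        using b_gt_1 by (simp add: F_def mult.assoc exp_add[symmetric])
    qed (use y in auto)
    then show False using psi_not_differentiable[OF n] y by blast
  qed
  moreover have "F (x + 1) = F x" for x
  proof -
    have "\<psi> (real b powr (x + 1)) = d * \<psi> (real b powr x)"
      using psi_mult_base[of "real b powr x"] b_gt_1 by (simp add: powr_add mult.commute)
    \<comment> \<open>Since \<open>exp L = d\<close>, whichever logarithm \<open>L\<close> is
      chosen, this factor cancels the \<open>d\<close> from \<open>\<psi>\<close>.\<close>
    moreover have "exp (- of_real (x + 1) * L) = exp (- of_real x * L) / d"
      by (simp add: expL[symmetric] exp_diff[symmetric] left_diff_distrib)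
    ultimately show ?thesis unfolding F_def using d_nonzero by (simp only:) simp
  qed
  moreover have "(\<Sum>n<N. \<tau> n) =
      F (log (real b) (real N)) * complex_of_real (real N) powr (L / complex_of_real (ln (real b)))"
    if "N \<ge> 1" for N
  proof -
    \<comment> \<open>The principal \<open>Ln\<close> of a positive integer is its real logarithm,
      so the power is the inverse of the exponential factor in \<open>F\<close>.\<close>
    have "complex_of_real (real N) powr (L / complex_of_real (ln (real b))) =
        exp (of_real (log (real b) (real N)) * L)"
      using that by (simp add: powr_def log_def Ln_of_nat mult.commute)
    then show ?thesis
      using that b_gt_1 by (simp add: F_def psi_of_nat S_def exp_minus)
  qed
  ultimately show ?thesis by blast
qed

end
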